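(* Suppose that $B$ is $E$-visible finite. The following statements are equivalent. (1) There exists no strict admissible pair. (2) There are finitely many admissible pairs. (3) $Q(\mathbf x)>0$ for every nonzero vector $\mathbf x\in\mathbb R_{\ge0}^t$. (4) $Q(\mathbf m)>0$ for every nonzero vector $\mathbf m\in\mathbb Z_{\ge0}^t$.
   Context: $\Bbbk$ is an algebraically closed field, $B$ is a finite-dimensional $\Bbbk$-algebra, $E$ is a finite-dimensional right $B$-module; all modules are finite-dimensional right modules. An indecomposable $B$-module $X$ is $E$-visible if $\mathrm{Hom}_B(E,X)\neq0$; $B$ is $E$-visible finite if there are only finitely many isomorphism classes of $E$-visible indecomposable $B$-modules. In that case let $X_1,\dots,X_t$ be a complete list of representatives. Set $d_i=\dim_\Bbbk\mathrm{Hom}_B(E,X_i)$, $\mathbf d=(d_1,\dots,d_t)$, $c_{ij}=\dim_\Bbbk\mathrm{Hom}_B(X_i,X_j)$, $\mathsf C=(c_{ij})$, $\mathsf G=(\mathsf C+\mathsf C^{\mathsf T})/2$. For $\mathbf x\in\mathbb R_{\ge0}^t$ define $h(\mathbf x)=\mathbf d\cdot\mathbf x$, $r(\mathbf x)=\mathbf x^{\mathsf T}\mathsf G\mathbf x$ and $Q(\mathbf x)=4r(\mathbf x)-h(\mathbf x)^2$. (For $\mathbf m\in\mathbb Z_{\ge0}^t$ and $N_{\mathbf m}=\bigoplus_iX_i^{m_i}$, one has $h(\mathbf m)=\dim_\Bbbk\mathrm{Hom}_B(E,N_{\mathbf m})$ and $r(\mathbf m)=\dim_\Bbbk\mathrm{End}_B(N_{\mathbf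 m})$.) A pair $(\mathbf m,\ell)$ with $0\ne\mathbf m\in\mathbb Z_{\ge0}^t$ and $\ell$ an integer with $1\le\ell\le h(\mathbf m)$ is admissible if $r(\mathbf m)-1\le\ell(h(\mathbf m)-\ell)$, and an admissible pair is strict if this inequality is strict. *)

theory Defs
  imports
    "HOL-Algebra.Algebraic_Closure"
    "Jordan_Normal_Form.Missing_VectorSpace"
    "Jordan_Normal_Form.Matrix"
begin

section \<open>Finite-dimensional algebras and right modules\<close>

text \<open>The locale \<^locale>\<open>algebra\<close> of HOL-Algebra covers commutative algebras only. The zero algebra
  is allowed.\<close>

locale fd_algebra = V: vectorspace K B + A: ring B
  for K :: "('k, 'c) ring_scheme" and B :: "('k, 'b, 'd) module_scheme" +
  assumes smult_mult_left:
      "\<lbrakk>c \<in> carrier K; a \<in> carrier B; b \<in> carrier B\<rbrakk>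
        \<Longrightarrow> (c \<odot>\<^bsub>B\<^esub> a) \<otimes>\<^bsub>B\<^esub> b = c \<odot>\<^bsub>B\<^esub> (a \<otimes>\<^bsub>B\<^esub> b)"
    and smult_mult_right:
      "\<lbrakk>c \<in> carrier K; a \<in> carrier B; b \<in> carrier B\<rbrakk>
        \<Longrightarrow> a \<otimes>\<^bsub>B\<^esub> (c \<odot>\<^bsub>B\<^esub> b) = c \<odot>\<^bsub>B\<^esub> (a \<otimes>\<^bsub>B\<^esub> b)"
    and finite_dim: "vectorspace.fin_dim K B"

text \<open>A right module is stored in the record of HOL-Algebra, whose scalar multiplication is written
  with the scalar on the left: \<open>b \<odot>\<^bsub>M\<^esub> x\<close> stands for \<open>x \<cdot> b\<close>. This is why the factors are swapped
  in \<open>act_mult\<close>. The multiplicative fields of the record of \<open>M\<close> are not used.\<close>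

locale right_module = B: ring B + M: abelian_group M
  for B :: "('b, 'c) ring_scheme" and M :: "('b, 'm, 'd) module_scheme" +
  assumes act_closed: "\<lbrakk>b \<in> carrier B; x \<in> carrier M\<rbrakk> \<Longrightarrow> b \<odot>\<^bsub>M\<^esub> x \<in> carrier M"
    and act_add_left:
      "\<lbrakk>b \<in> carrier B; x \<in> carrier M; y \<in> carrier M\<rbrakk>
        \<Longrightarrow> b \<odot>\<^bsub>M\<^esub> (x \<oplus>\<^bsub>M\<^esub> y) = b \<odot>\<^bsub>M\<^esub> x \<oplus>\<^bsub>M\<^esub> b \<odot>\<^bsub>M\<^esub> y"
    and act_add_right:
      "\<lbrakk>a \<in> carrier B; b \<in> carrier B; x \<in> carrier M\<rbrakk>
        \<Longrightarrow> (a \<oplus>\<^bsub>B\<^esub> b) \<odot>\<^bsub>M\<^esub> x = a \<odot>\<^bsub>M\<^esub> x \<oplus>\<^bsub>M\<^esub> b \<odot>\<^bsub>M\<^esub> x"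
    and act_mult:
      "\<lbrakk>a \<in> carrier B; b \<in> carrier B; x \<in> carrier M\<rbrakk>
        \<Longrightarrow> (a \<otimes>\<^bsub>B\<^esub> b) \<odot>\<^bsub>M\<^esub> x = b \<odot>\<^bsub>M\<^esub> (a \<odot>\<^bsub>M\<^esub> x)"
    and act_one: "x \<in> carrier M \<Longrightarrow> \<one>\<^bsub>B\<^esub> \<odot>\<^bsub>M\<^esub> x = x"

text \<open>The underlying vector space of a \<open>B\<close>-module: \<open>c\<close> acts as \<open>c \<cdot> 1\<^sub>B\<close>.\<close>

definition underlying_space ::
  "('k, 'b, 'c) module_scheme \<Rightarrow> ('b, 'm, 'd) module_scheme \<Rightarrow> ('k, 'm) module" where
  "underlying_space B M =
    \<lparr>carrier = carrier M, monoid.mult = monoid.mult M, one = one M, zero = zero M, add = add M,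
     smult = (\<lambda>c x. (c \<odot>\<^bsub>B\<^esub> \<one>\<^bsub>B\<^esub>) \<odot>\<^bsub>M\<^esub> x)\<rparr>"

lemma underlying_space_vectorspace:
  assumes "fd_algebra K B" and "right_module B M"
  shows "vectorspace K (underlying_space B M)"
proof -
  interpret B: fd_algebra K B by fact
  interpret M: right_module B M by fact
  have one: "c \<odot>\<^bsub>B\<^esub> \<one>\<^bsub>B\<^esub> \<in> carrier B" if "c \<in> carrier K" for c
    using that by simp
  have assoc: "((a \<otimes>\<^bsub>K\<^esub> b) \<odot>\<^bsub>B\<^esub> \<one>\<^bsub>B\<^esub>) = (b \<odot>\<^bsub>B\<^esub> \<one>\<^bsub>B\<^esub>) \<otimes>\<^bsub>B\<^esub> (a \<odot>\<^bsub>B\<^esub> \<one>\<^bsub>B\<^esub>)"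
    if "a \<in> carrier K" "b \<in> carrier K" for a b
    using that by (simp add: B.smult_mult_left B.V.smult_assoc1[symmetric] B.V.R.m_comm)
  have ag: "abelian_group (underlying_space B M)"
    apply (rule abelian_groupI)
    using M.M.l_neg M.M.a_inv_closed by (auto simp: underlying_space_def M.M.a_ac)
  have "module K (underlying_space B M)"
    apply (rule moduleI)
    apply (rule B.V.R.is_cring)
    apply (rule ag)
    by (auto simp: underlying_space_def M.act_closed one M.act_add_left M.act_add_right M.act_one B.V.smult_l_distr assoc M.act_mult)
  then show ?thesis
    unfolding vectorspace_def using B.V.field_axioms by blast
qed

definition fd_right_module ::
  "('k, 'a) ring_scheme \<Rightarrow> ('k, 'b, 'c) module_scheme \<Rightarrow> ('b, 'm, 'd) module_scheme \<Rightarrow> bool" where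
  "fd_right_module K B M \<longleftrightarrow>
    right_module B M \<and> vectorspace.fin_dim K (underlying_space B M)"

text \<open>Homomorphisms are taken extensional, so that a homomorphism is determined by its values on the
  carrier. The multiplicative fields of the record are irrelevant.\<close>

definition Hom_space ::
  "('k, 'b, 'c) module_scheme \<Rightarrow> ('b, 'm, 'd) module_scheme \<Rightarrow> ('b, 'n, 'e) module_scheme
    \<Rightarrow> ('k, 'm \<Rightarrow> 'n) module" where
  "Hom_space B M N =
    \<lparr>carrier = module_hom B M N \<inter> extensional (carrier M),
     monoid.mult = (\<lambda>f g. \<lambda>x\<in>carrier M. \<zero>\<^bsub>N\<^esub>),
     one = (\<lambda>x\<in>carrier M. \<zero>\<^bsub>N\<^esub>),
     zero = (\<lambda>x\<in>carrier M. \<zero>\<^bsub>N\<^esub>),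
     add = (\<lambda>f g. \<lambda>x\<in>carrier M. f x \<oplus>\<^bsub>N\<^esub> g x),
     smult = (\<lambda>c f. \<lambda>x\<in>carrier M. (c \<odot>\<^bsub>B\<^esub> \<one>\<^bsub>B\<^esub>) \<odot>\<^bsub>N\<^esub> f x)\<rparr>"

lemma Hom_space_vectorspace:
  assumes "fd_algebra K B" and "right_module B M" and "right_module B N"
  shows "vectorspace K (Hom_space B M N)"
proof -
  interpret B: fd_algebra K B by fact
  interpret M: right_module B M by fact
  interpret N: right_module B N by fact
  have one: "c \<odot>\<^bsub>B\<^esub> \<one>\<^bsub>B\<^esub> \<in> carrier B" if "c \<in> carrier K" for c
    using that by simp
  have assoc: "((a \<otimes>\<^bsub>K\<^esub> b) \<odot>\<^bsub>B\<^esub> \<one>\<^bsub>B\<^esub>) = (b \<odot>\<^bsub>B\<^esub> \<one>\<^bsub>B\<^esub>) \<otimes>\<^bsub>B\<^esub> (a \<odot>\<^bsub>B\<^esub> \<one>\<^bsub>B\<^esub>)"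
    if "a \<in> carrier K" "b \<in> carrier K" for a b
    using that by (simp add: B.smult_mult_left B.V.smult_assoc1[symmetric] B.V.R.m_comm)
  have cen: "(c \<odot>\<^bsub>B\<^esub> \<one>\<^bsub>B\<^esub>) \<odot>\<^bsub>N\<^esub> (b \<odot>\<^bsub>N\<^esub> x) = b \<odot>\<^bsub>N\<^esub> ((c \<odot>\<^bsub>B\<^esub> \<one>\<^bsub>B\<^esub>) \<odot>\<^bsub>N\<^esub> x)"
    if "c \<in> carrier K" "b \<in> carrier B" "x \<in> carrier N" for b c x
    using that by (simp add: N.act_mult[symmetric] one B.smult_mult_left B.smult_mult_right)
  have zr: "b \<odot>\<^bsub>N\<^esub> \<zero>\<^bsub>N\<^esub> = \<zero>\<^bsub>N\<^esub>" if "b \<in> carrier B" for b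
    using that N.act_add_left[of b "\<zero>\<^bsub>N\<^esub>" "\<zero>\<^bsub>N\<^esub>"] N.act_closed[of b "\<zero>\<^bsub>N\<^esub>"]
    by (metis N.M.r_zero N.M.zero_closed N.M.add.l_cancel_one)
  have clo: "f x \<in> carrier N" if "f \<in> module_hom B M N" "x \<in> carrier M" for f x
    using that by (auto simp: module_hom_def)
  have neg: "(\<lambda>x\<in>carrier M. \<ominus>\<^bsub>N\<^esub> f x) \<in> module_hom B M N" if "f \<in> module_hom B M N" for f
  proof -
    have "b \<odot>\<^bsub>N\<^esub> (\<ominus>\<^bsub>N\<^esub> y) = \<ominus>\<^bsub>N\<^esub> (b \<odot>\<^bsub>N\<^esub> y)" if "b \<in> carrier B" "y \<in> carrier N" for b y
      using that N.act_add_left[of b "\<ominus>\<^bsub>N\<^esub> y" y] zr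
      by (metis N.M.a_inv_closed N.M.l_neg N.M.minus_equality N.act_closed)
    then show ?thesis using that
      by (auto simp: module_hom_def N.M.minus_add Pi_iff M.act_closed N.M.a_comm)
  qed
  have ag: "abelian_group (Hom_space B M N)"
    apply (rule abelian_groupI)
    subgoal by (auto simp: Hom_space_def module_hom_def Pi_iff N.act_add_left M.act_closed N.M.a_ac)
    subgoal by (auto simp: Hom_space_def module_hom_def Pi_iff M.act_closed zr)
    subgoal by (auto simp: Hom_space_def N.M.a_ac clo fun_eq_iff restrict_def)
    subgoal by (auto simp: Hom_space_def N.M.a_ac clo fun_eq_iff restrict_def)
    subgoal by (auto simp: Hom_space_def N.M.a_ac clo fun_eq_iff restrict_def extensional_def)
    subgoal for f
      apply (rule bexI[of _ "\<lambda>x\<in>carrier M. \<ominus>\<^bsub>N\<^esub> f x"])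
      using neg[of f] by (auto simp: Hom_space_def clo fun_eq_iff restrict_def extensional_def N.M.l_neg)
    done
  have "module K (Hom_space B M N)"
    apply (rule moduleI)
    apply (rule B.V.R.is_cring)
    apply (rule ag)
    subgoal by (auto simp: Hom_space_def module_hom_def Pi_iff N.act_add_left M.act_closed N.act_closed one cen)
    subgoal by (auto simp: Hom_space_def clo fun_eq_iff B.V.smult_l_distr N.act_add_right one)
    subgoal by (auto simp: Hom_space_def clo fun_eq_iff N.act_add_left one)
    subgoal by (auto simp: Hom_space_def clo fun_eq_iff assoc N.act_mult N.act_closed one)
    subgoal by (auto simp: Hom_space_def clo fun_eq_iff N.act_one extensional_def)
    done
  then show ?thesis
    unfolding vectorspace_def using B.V.field_axioms by blast
qed

definition hom_dim ::
  "('k, 'a) ring_scheme \<Rightarrow> ('k, 'b, 'c) module_scheme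
    \<Rightarrow> ('b, 'm, 'd) module_scheme \<Rightarrow> ('b, 'n, 'e) module_scheme \<Rightarrow> nat" where
  "hom_dim K B M N = vectorspace.dim K (Hom_space B M N)"

definition module_iso ::
  "('b, 'c) ring_scheme \<Rightarrow> ('b, 'm, 'd) module_scheme \<Rightarrow> ('b, 'n, 'e) module_scheme \<Rightarrow> bool" where
  "module_iso B M N \<longleftrightarrow> (\<exists>f \<in> module_hom B M N. bij_betw f (carrier M) (carrier N))"

definition indecomposable ::
  "('b, 'c) ring_scheme \<Rightarrow> ('b, 'm, 'd) module_scheme \<Rightarrow> bool" where
  "indecomposable B M \<longleftrightarrow>
    carrier M \<noteq> {\<zero>\<^bsub>M\<^esub>} \<and>
    (\<forall>U V. Module.submodule U B M \<and> Module.submodule V B M \<and>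
           U \<inter> V = {\<zero>\<^bsub>M\<^esub>} \<and> U <+>\<^bsub>M\<^esub> V = carrier M
           \<longrightarrow> U = {\<zero>\<^bsub>M\<^esub>} \<or> V = {\<zero>\<^bsub>M\<^esub>})"

section \<open>Visible modules\<close>

text \<open>Isomorphism classes are formed among modules with carrier in the type \<open>nat \<Rightarrow> 'k\<close>, where
  \<open>'k\<close> is the type of the ground field. Nothing is lost: every finite-dimensional module, over
  whatever type, has an isomorphic copy there.\<close>

lemma fd_right_module_copy:
  fixes K :: "('k, 'a) ring_scheme" and B :: "('k, 'b, 'c) module_scheme"
    and M :: "('b, 'm, 'd) module_scheme"
  assumes "fd_algebra K B" and "fd_right_module K B M"
  shows "\<exists>N :: ('b, nat \<Rightarrow> 'k) module. fd_right_module K B N \<and> module_iso B M N"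
proof -
  interpret B: fd_algebra K B by fact
  have rm: "right_module B M" and fd: "vectorspace.fin_dim K (underlying_space B M)"
    using assms(2) by (auto simp: fd_right_module_def)
  interpret M: right_module B M by fact
  interpret U: vectorspace K "underlying_space B M"
    by (rule underlying_space_vectorspace[OF assms(1) rm])
  have carr: "carrier (underlying_space B M) = carrier M" by (simp add: underlying_space_def)
  obtain A where A: "finite A" "A \<subseteq> carrier M" "U.span A = carrier M"
    using fd unfolding U.fin_dim_def carr by blast
  have "\<forall>x\<in>carrier M. \<exists>a \<in> A \<rightarrow> carrier K. U.lincomb a A = x"
  proof
    fix x assume "x \<in> carrier M"
    then have "x \<in> {U.lincomb a A |a. a \<in> A \<rightarrow> carrier K}"
      using A U.finite_span[of A] unfolding carr by (metis (no_types))
    then show "\<exists>a \<in> A \<rightarrow> carrier K. U.lincomb a A = x" by auto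
  qed
  then obtain co where co: "\<And>x. x \<in> carrier M \<Longrightarrow> U.lincomb (co x) A = x"
    and coc: "\<And>x. x \<in> carrier M \<Longrightarrow> co x \<in> A \<rightarrow> carrier K" by metis
  obtain e :: "'m \<Rightarrow> nat" where e: "inj_on e A"
    using finite_imp_inj_to_nat_seg[OF A(1)] by blast
  define \<phi> where "\<phi> x = (\<lambda>n. co x (inv_into A e n))" for x
  have inj: "inj_on \<phi> (carrier M)"
  proof (rule inj_onI)
    fix x y assume xy: "x \<in> carrier M" "y \<in> carrier M" "\<phi> x = \<phi> y"
    have eq: "co x v = co y v" if "v \<in> A" for v
      using fun_cong[OF xy(3), of "e v"] that e by (simp add: \<phi>_def)
    have "U.lincomb (co x) A = U.lincomb (co y) A"
      unfolding U.lincomb_def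
      apply (rule U.finsum_cong')
      using eq coc[OF xy(2)] A(2) U.smult_closed carr by (auto simp: Pi_iff subset_iff)
    then show "x = y" using co xy by metis
  qed
  define \<psi> where "\<psi> = inv_into (carrier M) \<phi>"
  have \<psi>[simp]: "\<psi> (\<phi> x) = x" if "x \<in> carrier M" for x
    using that inj by (simp add: \<psi>_def)
  define N :: "('b, nat \<Rightarrow> 'k) module" where
    "N = \<lparr>carrier = \<phi> ` carrier M, monoid.mult = undefined, one = undefined, zero = \<phi> \<zero>\<^bsub>M\<^esub>,
      add = (\<lambda>f g. \<phi> (\<psi> f \<oplus>\<^bsub>M\<^esub> \<psi> g)), smult = (\<lambda>b f. \<phi> (b \<odot>\<^bsub>M\<^esub> \<psi> f))\<rparr>"
  have agN: "abelian_group N"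
    apply (rule abelian_groupI)
    subgoal by (auto simp: N_def)
    subgoal by (auto simp: N_def)
    subgoal by (auto simp: N_def M.M.a_ac)
    subgoal by (auto simp: N_def M.M.a_ac)
    subgoal by (auto simp: N_def)
    subgoal for x by (rule bexI[of _ "\<phi> (\<ominus>\<^bsub>M\<^esub> \<psi> x)"]) (auto simp: N_def M.M.l_neg)
    done
  have rmN: "right_module B N"
    unfolding right_module_def right_module_axioms_def
    using agN B.A.ring_axioms
    by (auto simp: N_def M.act_closed M.act_add_left M.act_add_right M.act_mult M.act_one)
  interpret UN: vectorspace K "underlying_space B N"
    by (rule underlying_space_vectorspace[OF assms(1) rmN])
  have "\<phi> \<in> module_hom B M N"
    by (auto simp: module_hom_def N_def M.act_closed)
  moreover have "bij_betw \<phi> (carrier M) (carrier N)"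
    using inj by (simp add: N_def bij_betw_def)
  ultimately have iso: "module_iso B M N" unfolding module_iso_def by blast
  have lm: "linear_map K (underlying_space B M) (underlying_space B N) \<phi>"
    unfolding linear_map_def mod_hom_def mod_hom_axioms_def
    using U.vectorspace_axioms UN.vectorspace_axioms
    by (auto simp: vectorspace_def module_hom_def underlying_space_def N_def M.act_closed)
  interpret L: linear_map K "underlying_space B M" "underlying_space B N" \<phi> by (rule lm)
  have "UN.fin_dim"
    by (rule L.rank_nullity_main(2)[OF fd]) (simp add: underlying_space_def N_def)
  then show ?thesis using rmN iso by (auto simp: fd_right_module_def)
qed

definition visible_modules ::
  "('k, 'a) ring_scheme \<Rightarrow> ('k, 'b, 'c) module_scheme \<Rightarrow> ('b, 'm, 'd) module_scheme
    \<Rightarrow> ('b, nat \<Rightarrow> 'k) module set" where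
  "visible_modules K B E =
    {M. fd_right_module K B M \<and> indecomposable B M \<and>
        carrier (Hom_space B E M) \<noteq> {\<zero>\<^bsub>Hom_space B E M\<^esub>}}"

definition visible_finite ::
  "('k, 'a) ring_scheme \<Rightarrow> ('k, 'b, 'c) module_scheme \<Rightarrow> ('b, 'm, 'd) module_scheme \<Rightarrow> bool" where
  "visible_finite K B E \<longleftrightarrow>
    finite (visible_modules K B E //
      {(M, N). M \<in> visible_modules K B E \<and> N \<in> visible_modules K B E \<and> module_iso B M N})"

definition complete_representatives ::
  "('k, 'a) ring_scheme \<Rightarrow> ('k, 'b, 'c) module_scheme \<Rightarrow> ('b, 'm, 'd) module_scheme
    \<Rightarrow> ('b, nat \<Rightarrow> 'k) module list \<Rightarrow> bool" where
  "complete_representatives K B E Xs \<longleftrightarrow>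
    set Xs \<subseteq> visible_modules K B E \<and>
    (\<forall>i < length Xs. \<forall>j < length Xs. i \<noteq> j \<longrightarrow> \<not> module_iso B (Xs ! i) (Xs ! j)) \<and>
    (\<forall>M \<in> visible_modules K B E. \<exists>i < length Xs. module_iso B M (Xs ! i))"

section \<open>The quadratic form and admissible pairs\<close>

definition d_vec ::
  "('k, 'a) ring_scheme \<Rightarrow> ('k, 'b, 'c) module_scheme \<Rightarrow> ('b, 'm, 'd) module_scheme
    \<Rightarrow> ('b, 'n) module list \<Rightarrow> real vec" where
  "d_vec K B E Xs = vec (length Xs) (\<lambda>i. real (hom_dim K B E (Xs ! i)))"

definition C_mat ::
  "('k, 'a) ring_scheme \<Rightarrow> ('k, 'b, 'c) module_scheme \<Rightarrow> ('b, 'n) module list \<Rightarrow> real mat" where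
  "C_mat K B Xs =
    mat (length Xs) (length Xs) (\<lambda>(i, j). real (hom_dim K B (Xs ! i) (Xs ! j)))"

definition G_mat ::
  "('k, 'a) ring_scheme \<Rightarrow> ('k, 'b, 'c) module_scheme \<Rightarrow> ('b, 'n) module list \<Rightarrow> real mat" where
  "G_mat K B Xs = (1 / 2) \<cdot>\<^sub>m (C_mat K B Xs + transpose_mat (C_mat K B Xs))"

definition h_form ::
  "('k, 'a) ring_scheme \<Rightarrow> ('k, 'b, 'c) module_scheme \<Rightarrow> ('b, 'm, 'd) module_scheme
    \<Rightarrow> ('b, 'n) module list \<Rightarrow> real vec \<Rightarrow> real" where
  "h_form K B E Xs x = d_vec K B E Xs \<bullet> x"

definition r_form ::
  "('k, 'a) ring_scheme \<Rightarrow> ('k, 'b, 'c) module_scheme \<Rightarrow> ('b, 'n) module list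
    \<Rightarrow> real vec \<Rightarrow> real" where
  "r_form K B Xs x = x \<bullet> (G_mat K B Xs *\<^sub>v x)"

definition Q_form ::
  "('k, 'a) ring_scheme \<Rightarrow> ('k, 'b, 'c) module_scheme \<Rightarrow> ('b, 'm, 'd) module_scheme
    \<Rightarrow> ('b, 'n) module list \<Rightarrow> real vec \<Rightarrow> real" where
  "Q_form K B E Xs x = 4 * r_form K B Xs x - (h_form K B E Xs x)\<^sup>2"

definition admissible ::
  "('k, 'a) ring_scheme \<Rightarrow> ('k, 'b, 'c) module_scheme \<Rightarrow> ('b, 'm, 'd) module_scheme
    \<Rightarrow> ('b, 'n) module list \<Rightarrow> nat vec \<Rightarrow> int \<Rightarrow> bool" where
  "admissible K B E Xs m l \<longleftrightarrow>
    m \<in> carrier_vec (length Xs) \<and> m \<noteq> 0\<^sub>v (length Xs) \<and>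
    1 \<le> l \<and> real_of_int l \<le> h_form K B E Xs (map_vec real m) \<and>
    r_form K B Xs (map_vec real m) - 1
      \<le> real_of_int l * (h_form K B E Xs (map_vec real m) - real_of_int l)"

definition strict_admissible ::
  "('k, 'a) ring_scheme \<Rightarrow> ('k, 'b, 'c) module_scheme \<Rightarrow> ('b, 'm, 'd) module_scheme
    \<Rightarrow> ('b, 'n) module list \<Rightarrow> nat vec \<Rightarrow> int \<Rightarrow> bool" where
  "strict_admissible K B E Xs m l \<longleftrightarrow>
    admissible K B E Xs m l \<and>
    r_form K B Xs (map_vec real m) - 1
      < real_of_int l * (h_form K B E Xs (map_vec real m) - real_of_int l)"

end

theory Submission
  imports
    "HOL-Analysis.Function_Topology"
    "HOL-Analysis.Kronecker_Approximation_Theorem"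
    Defs
begin

text \<open>Completing the square gives, for a vector \<open>m\<close> of multiplicities and an integer \<open>l\<close>,
\<open>4 (r(m) - l (h(m) - l)) = Q(m) + (h(m) - 2 l)\<^sup>2\<close>. So a pair is admissible if the right-hand side
is at most \<open>4\<close>, and strict if it is less than \<open>4\<close>. As \<open>r(m)\<close> and \<open>h(m)\<close> are integers, the right-hand
side is a multiple of \<open>4\<close>; for a strict pair it is thus at most \<open>0\<close>, hence \<open>Q(m) \<le> 0\<close>
(\<open>Q_form_nonpos_if_strict_admissible\<close>). Conversely, if \<open>Q(m) \<le> 0\<close> and \<open>m \<noteq> 0\<close>, then every pair
\<open>(2 k m, k h(m))\<close> with \<open>k > 0\<close> makes the square vanish and is strict
(\<open>strict_admissible_even_multiple\<close>). Therefore positivity of \<open>Q\<close> on vectors of natural numbers is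
equivalent to the absence of strict pairs, and it follows from the finiteness of the set of
admissible pairs.

If \<open>Q\<close> is positive on the nonzero real vectors of the cone, compactness of the simplex bounds \<open>Q\<close>
below by a multiple of the squared coordinate sum, so \<open>Q(m) \<le> 4\<close> has finitely many solutions
in natural numbers, and there are finitely many admissible pairs
(\<open>finite_admissible_if_strictly_copositive\<close>).

There remains the step from natural to real vectors, a fact on quadratic forms with integer
coefficients (\<open>strictly_copositive_if_pos_on_nat_vectors\<close>). The delicate case is a nonzero real
vector \<open>x\<close> of the cone with \<open>Q(x) = 0\<close>. If \<open>Q\<close> is nonnegative on the cone, \<open>x\<close> is a minimum, so the
partial derivatives in the directions of its support vanish. Dirichlet's theorem on simultaneous
approximation gives a multiple \<open>q x\<close> and a nonzero vector \<open>m\<close> of natural numbers, with the same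
support, such that \<open>m = q x + \<delta>\<close> with \<open>\<delta>\<close> small. The linear term vanishes, so
\<open>Q(m) = Q(\<delta>) < 1\<close>, and the integer \<open>Q(m)\<close> is not positive.

The modules enter through the positivity of every \<open>d\<^sub>i\<close> (\<open>hom_dim_pos_if_visible\<close>), which gives
\<open>h(m) > 0\<close> for \<open>m \<noteq> 0\<close>. Since the dimension is defined as the least size of a finite spanning set,
the Hom spaces must first be shown to be finite-dimensional.\<close>

unbundle no vec_syntax
hide_type (open) Finite_Cartesian_Product.vec

section \<open>Hom spaces are finite-dimensional\<close>

text \<open>The image of \<open>U\<close> is a subspace of a finite-dimensional space; lift a maximal independent subset
of it to \<open>U\<close>.\<close>

lemma image_covered_by_finite_span:
  assumes lin: "linear_map K V W T" and fd: "vectorspace.fin_dim K W" and U: "submodule K U V"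
  shows "\<exists>F. finite F \<and> F \<subseteq> U \<and> T ` U \<subseteq> T ` module.span K V F"
proof -
  interpret V: vectorspace K V using lin by (simp add: linear_map_def)
  interpret W: vectorspace K W using lin by (simp add: linear_map_def)
  interpret linear_map K V W T by fact
  have UV: "U \<subseteq> carrier V" using U by (rule submodule.subset)
  then have TU: "T ` U \<subseteq> carrier W" by auto
  have "\<exists>A. finite A \<and> maximal A (\<lambda>S. S \<subseteq> T ` U \<and> W.lin_indpt S)"
  proof (rule maximal_exists[where N = "W.dim" and B = "{}"])
    show "finite A \<and> card A \<le> W.dim" if "A \<subseteq> T ` U \<and> W.lin_indpt A" for A
      using that TU W.li_le_dim[OF fd, of A] by blast
    show "{} \<subseteq> T ` U \<and> W.lin_indpt {}"
      by (auto simp: W.lin_dep_def)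
  qed
  then obtain A where finA: "finite A" and maxA: "maximal A (\<lambda>S. S \<subseteq> T ` U \<and> W.lin_indpt S)"
    by blast
  have A: "A \<subseteq> T ` U" "W.lin_indpt A" using maxA by (simp_all add: maximal_def)
  have max: "S = A" if "A \<subseteq> S" "S \<subseteq> T ` U" "W.lin_indpt S" for S
    using maxA that by (simp add: maximal_def)
  obtain F where F: "finite F" "F \<subseteq> U" "A = T ` F"
    using finite_subset_image[OF finA A(1)] by blast
  have FV: "F \<subseteq> carrier V" using F(2) UV by blast
  have spF: "submodule K (V.span F) V" by (rule V.span_is_submodule[OF FV])
  have spV: "V.span F \<subseteq> carrier V" by (rule submodule.subset[OF spF])
  have img: "submodule K (T ` V.span F) W"
  proof (rule submodule.intro)
    show "module K W" by (rule W.module_axioms)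
    show "T ` V.span F \<subseteq> carrier W" using spV by auto
    show "v \<oplus>\<^bsub>W\<^esub> w \<in> T ` V.span F" if vw: "v \<in> T ` V.span F" "w \<in> T ` V.span F" for v w
    proof -
      obtain x y where "x \<in> V.span F" "y \<in> V.span F" "v = T x" "w = T y" using vw by blast
      then have "v \<oplus>\<^bsub>W\<^esub> w = T (x \<oplus>\<^bsub>V\<^esub> y)" "x \<oplus>\<^bsub>V\<^esub> y \<in> V.span F"
        using spV submodule.m_closed[OF spF] by (auto simp: subset_iff)
      then show ?thesis by blast
    qed
    have "\<zero>\<^bsub>W\<^esub> = T \<zero>\<^bsub>V\<^esub>" by simp
    then show "\<zero>\<^bsub>W\<^esub> \<in> T ` V.span F" using submodule.zero_closed[OF spF] by blast
    show "c \<odot>\<^bsub>W\<^esub> v \<in> T ` V.span F" if cv: "c \<in> carrier K" "v \<in> T ` V.span F" for c v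
    proof -
      obtain x where "x \<in> V.span F" "v = T x" using cv by blast
      then have "c \<odot>\<^bsub>W\<^esub> v = T (c \<odot>\<^bsub>V\<^esub> x)" "c \<odot>\<^bsub>V\<^esub> x \<in> V.span F"
        using cv spV submodule.smult_closed[OF spF] by (auto simp: subset_iff)
      then show ?thesis by blast
    qed
  qed
  have Asp: "A \<subseteq> T ` V.span F" using F(3) V.in_own_span[OF FV] by blast
  have AW: "A \<subseteq> carrier W" using A(1) TU by blast
  have "w \<in> T ` V.span F" if w: "w \<in> T ` U" for w
  proof (cases "w \<in> A")
    case True
    then show ?thesis using Asp by blast
  next
    case False
    have "\<not> W.lin_indpt (A \<union> {w})"
      using max[of "A \<union> {w}"] A(1) w False by blast
    then have "w \<in> W.span A"
      using W.lin_dep_iff_in_span[OF AW A(2) _ False] w TU by blast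
    then show ?thesis using W.span_is_subset[OF Asp img] by blast
  qed
  then show ?thesis using F by blast
qed

text \<open>The joint map \<open>V \<rightarrow> W\<^sup>A\<close> is injective. Instead of forming the power of \<open>W\<close>, the proof adds the maps one
at a time: a finite set \<open>F\<close> whose span realises every joint value of the maps in \<open>S\<close> is enlarged by
finitely many vectors of the common kernel of these maps, which correct the value of the next map
and leave the earlier values unchanged.\<close>

lemma fin_dim_if_jointly_injective:
  assumes "finite A" and V: "vectorspace K V" and W: "vectorspace K W"
    and fd: "vectorspace.fin_dim K W"
    and lin: "\<And>a. a \<in> A \<Longrightarrow> linear_map K V W (T a)"
    and inj: "\<And>v. v \<in> carrier V \<Longrightarrow> \<forall>a\<in>A. T a v = \<zero>\<^bsub>W\<^esub> \<Longrightarrow> v = \<zero>\<^bsub>V\<^esub>"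
  shows "vectorspace.fin_dim K V"
proof -
  interpret V: vectorspace K V by fact
  interpret W: vectorspace K W by fact
  have add_diff: "g \<oplus>\<^bsub>V\<^esub> (v \<ominus>\<^bsub>V\<^esub> g) = v" if "g \<in> carrier V" "v \<in> carrier V" for g v
    using that by (simp add: a_minus_def V.M.a_comm[of v] V.M.r_neg2)
  have "\<exists>F. finite F \<and> F \<subseteq> carrier V \<and>
      (\<forall>v\<in>carrier V. \<exists>g\<in>V.span F. \<forall>a\<in>S. T a g = T a v)" if "finite S" "S \<subseteq> A" for S
    using that
  proof (induction S rule: finite_induct)
    case empty
    have "{} \<subseteq> carrier V" by simp
    then have "\<zero>\<^bsub>V\<^esub> \<in> V.span {}" using V.span_is_submodule[of "{}"] submodule.zero_closed by blast
    then show ?case by blast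
  next
    case (insert b S)
    then obtain F where F: "finite F" "F \<subseteq> carrier V"
      and FS: "\<And>v. v \<in> carrier V \<Longrightarrow> \<exists>g\<in>V.span F. \<forall>a\<in>S. T a g = T a v" by blast
    have linS: "linear_map K V W (T a)" if "a \<in> S" for a using that insert lin by blast
    interpret Tb: linear_map K V W "T b" using insert lin by blast
    define U where "U = {v \<in> carrier V. \<forall>a\<in>S. T a v = \<zero>\<^bsub>W\<^esub>}"
    have add: "T a (v \<oplus>\<^bsub>V\<^esub> w) = T a v \<oplus>\<^bsub>W\<^esub> T a w"
      if "a \<in> insert b S" "v \<in> carrier V" "w \<in> carrier V" for a v w
    proof -
      interpret Ta: linear_map K V W "T a" using that insert lin by blast
      show ?thesis using that by simp
    qed
    have minus: "T a (v \<ominus>\<^bsub>V\<^esub> w) = T a v \<ominus>\<^bsub>W\<^esub> T a w" and im: "T a v \<in> carrier W"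
      if "a \<in> insert b S" "v \<in> carrier V" "w \<in> carrier V" for a v w
    proof -
      interpret Ta: linear_map K V W "T a" using that insert lin by blast
      show "T a (v \<ominus>\<^bsub>V\<^esub> w) = T a v \<ominus>\<^bsub>W\<^esub> T a w" "T a v \<in> carrier W" using that by simp_all
    qed
    have U: "submodule K U V"
    proof (rule submodule.intro)
      show "module K V" by (rule V.module_axioms)
      show "U \<subseteq> carrier V" by (auto simp: U_def)
      show "v \<oplus>\<^bsub>V\<^esub> w \<in> U" if "v \<in> U" "w \<in> U" for v w
        using that by (auto simp: U_def add)
      show "\<zero>\<^bsub>V\<^esub> \<in> U"
      proof -
        have "T a \<zero>\<^bsub>V\<^esub> = \<zero>\<^bsub>W\<^esub>" if "a \<in> S" for a
        proof -
          interpret Ta: linear_map K V W "T a" by (rule linS[OF that])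
          show ?thesis by simp
        qed
        then show ?thesis by (simp add: U_def)
      qed
      show "c \<odot>\<^bsub>V\<^esub> v \<in> U" if "c \<in> carrier K" "v \<in> U" for c v
      proof -
        have "T a (c \<odot>\<^bsub>V\<^esub> v) = \<zero>\<^bsub>W\<^esub>" if "a \<in> S" for a
        proof -
          interpret Ta: linear_map K V W "T a" by (rule linS[OF that])
          show ?thesis using \<open>c \<in> carrier K\<close> \<open>v \<in> U\<close> that by (simp add: U_def)
        qed
        then show ?thesis using that by (simp add: U_def)
      qed
    qed
    obtain G where G: "finite G" "G \<subseteq> U" "T b ` U \<subseteq> T b ` V.span G"
      using image_covered_by_finite_span[OF Tb.linear_map_axioms fd U] by blast
    have GV: "G \<subseteq> carrier V" using G(2) by (auto simp: U_def)
    have GU: "V.span G \<subseteq> U" by (rule V.span_is_subset[OF G(2) U])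
    have FGV: "F \<union> G \<subseteq> carrier V" using F GV by blast
    have "\<exists>g\<in>V.span (F \<union> G). \<forall>a\<in>insert b S. T a g = T a v" if v: "v \<in> carrier V" for v
    proof -
      obtain f where f: "f \<in> V.span F" "\<And>a. a \<in> S \<Longrightarrow> T a f = T a v" using FS[OF v] by blast
      have fV: "f \<in> carrier V" using f V.span_is_subset2[OF F(2)] by blast
      have "v \<ominus>\<^bsub>V\<^esub> f \<in> U"
      proof -
        have "T a (v \<ominus>\<^bsub>V\<^esub> f) = \<zero>\<^bsub>W\<^esub>" if a: "a \<in> S" for a
        proof -
          have ab: "a \<in> insert b S" using a by simp
          show ?thesis
            using minus[OF ab v fV] im[OF ab v v] f(2)[OF a] by (simp add: W.M.r_neg a_minus_def)
        qed
        then show ?thesis using v fV by (simp add: U_def)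
      qed
      then have "T b (v \<ominus>\<^bsub>V\<^esub> f) \<in> T b ` V.span G" by (rule subsetD[OF G(3) imageI])
      then obtain g where g: "g \<in> V.span G" "T b g = T b (v \<ominus>\<^bsub>V\<^esub> f)" by (auto simp: image_iff)
      have gU: "g \<in> U" using g GU by blast
      then have gV: "g \<in> carrier V" by (simp add: U_def)
      have "f \<oplus>\<^bsub>V\<^esub> g \<in> V.span (F \<union> G)"
        using V.span_is_submodule[OF FGV] f(1) g(1) V.span_is_monotone[of F "F \<union> G"]
          V.span_is_monotone[of G "F \<union> G"]
        by (meson Un_upper1 Un_upper2 submodule.m_closed subsetD)
      moreover have "T a (f \<oplus>\<^bsub>V\<^esub> g) = T a v" if a: "a \<in> insert b S" for a
      proof (cases "a = b")
        case True
        have "f \<oplus>\<^bsub>V\<^esub> (v \<ominus>\<^bsub>V\<^esub> f) = v"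
          using add_diff[OF fV v] .
        moreover have "T a (f \<oplus>\<^bsub>V\<^esub> g) = T a (f \<oplus>\<^bsub>V\<^esub> (v \<ominus>\<^bsub>V\<^esub> f))"
          using True g(2) fV gV v by (simp add: add)
        ultimately show ?thesis by simp
      next
        case False
        then have "a \<in> S" using a by blast
        then show ?thesis using add[OF a fV gV] gU f(2) im[OF a v v] by (simp add: U_def)
      qed
      ultimately show ?thesis by blast
    qed
    then show ?case using F(1) G(1) FGV by (intro exI[of _ "F \<union> G"]) blast
  qed
  from this[OF \<open>finite A\<close> order.refl] obtain F where F: "finite F" "F \<subseteq> carrier V"
    and sp: "\<And>v. v \<in> carrier V \<Longrightarrow> \<exists>g\<in>V.span F. \<forall>a\<in>A. T a g = T a v" by blast
  have "v \<in> V.span F" if v: "v \<in> carrier V" for v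
  proof -
    obtain g where g: "g \<in> V.span F" "\<And>a. a \<in> A \<Longrightarrow> T a g = T a v" using sp[OF v] by blast
    have gV: "g \<in> carrier V" using g V.span_is_subset2[OF F(2)] by blast
    have "T a (v \<ominus>\<^bsub>V\<^esub> g) = \<zero>\<^bsub>W\<^esub>" if "a \<in> A" for a
    proof -
      interpret Ta: linear_map K V W "T a" by (rule lin[OF that])
      have "T a v \<in> carrier W" using v by simp
      then show ?thesis using v gV g(2)[OF that] by (simp add: W.M.r_neg a_minus_def)
    qed
    then have "v \<ominus>\<^bsub>V\<^esub> g = \<zero>\<^bsub>V\<^esub>" using v gV by (intro inj) auto
    then have "v = g" using add_diff[OF gV v] gV by simp
    then show ?thesis using g(1) by simp
  qed
  then have "V.span F = carrier V" using V.span_is_subset2[OF F(2)] by blast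
  then show ?thesis using F unfolding V.fin_dim_def by blast
qed

text \<open>A homomorphism is determined by its values on a finite spanning set of \<open>M\<close>, so the evaluations
at that set are jointly injective.\<close>

lemma Hom_space_fin_dim:
  assumes "fd_algebra K B" and "fd_right_module K B M" and "fd_right_module K B N"
  shows "vectorspace.fin_dim K (Hom_space B M N)"
proof -
  have rm: "right_module B M" "right_module B N"
    and fdM: "vectorspace.fin_dim K (underlying_space B M)"
    and fdN: "vectorspace.fin_dim K (underlying_space B N)"
    using assms by (auto simp: fd_right_module_def)
  interpret B: fd_algebra K B by fact
  interpret M: right_module B M by fact
  interpret N: right_module B N by fact
  interpret UM: vectorspace K "underlying_space B M"
    by (rule underlying_space_vectorspace[OF assms(1) rm(1)])
  interpret UN: vectorspace K "underlying_space B N"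
    by (rule underlying_space_vectorspace[OF assms(1) rm(2)])
  interpret H: vectorspace K "Hom_space B M N"
    by (rule Hom_space_vectorspace[OF assms(1) rm])
  obtain A where A: "finite A" "A \<subseteq> carrier (underlying_space B M)"
      "UM.span A = carrier (underlying_space B M)"
    using fdM unfolding UM.fin_dim_def by blast
  have AM: "A \<subseteq> carrier M" using A(2) by (simp add: underlying_space_def)
  show ?thesis
  proof (rule fin_dim_if_jointly_injective[OF A(1) H.vectorspace_axioms UN.vectorspace_axioms fdN])
    show "linear_map K (Hom_space B M N) (underlying_space B N) (\<lambda>f. f a)" if "a \<in> A" for a
      unfolding linear_map_def mod_hom_def mod_hom_axioms_def
      using H.vectorspace_axioms UN.vectorspace_axioms that AM
      by (auto simp: vectorspace_def module_hom_def underlying_space_def Hom_space_def)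
    show "f = \<zero>\<^bsub>Hom_space B M N\<^esub>"
      if f: "f \<in> carrier (Hom_space B M N)" and f0: "\<forall>a\<in>A. f a = \<zero>\<^bsub>underlying_space B N\<^esub>" for f
    proof -
      interpret F: linear_map K "underlying_space B M" "underlying_space B N" f
        unfolding linear_map_def mod_hom_def mod_hom_axioms_def
        using UM.vectorspace_axioms UN.vectorspace_axioms f
        by (auto simp: vectorspace_def module_hom_def underlying_space_def Hom_space_def)
      have "A \<subseteq> F.ker" using A(2) f0 by (auto simp: F.ker_def)
      then have "UM.span A \<subseteq> F.ker" by (rule UM.span_is_subset[OF _ F.ker_is_submodule])
      then have ker: "carrier (underlying_space B M) \<subseteq> F.ker" using A(3) by simp
      have "f x = \<zero>\<^bsub>N\<^esub>" if "x \<in> carrier M" for x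
      proof -
        have "x \<in> F.ker" using ker that by (auto simp: underlying_space_def)
        then have "f x = \<zero>\<^bsub>underlying_space B N\<^esub>" by (rule F.f_ker)
        then show ?thesis by (simp add: underlying_space_def)
      qed
      then show ?thesis using f by (auto simp: Hom_space_def extensional_def fun_eq_iff)
    qed
  qed
qed

lemma hom_dim_pos_if_visible:
  assumes "fd_algebra K B" and "fd_right_module K B E" and N: "N \<in> visible_modules K B E"
  shows "0 < hom_dim K B E N"
proof -
  have fdN: "fd_right_module K B N" and nz: "carrier (Hom_space B E N) \<noteq> {\<zero>\<^bsub>Hom_space B E N\<^esub>}"
    using N by (auto simp: visible_modules_def)
  interpret H: vectorspace K "Hom_space B E N"
    using assms(2) fdN by (intro Hom_space_vectorspace[OF assms(1)]) (auto simp: fd_right_module_def)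
  obtain S where S: "finite S" "H.basis S"
    using H.finite_basis_exists[OF Hom_space_fin_dim[OF assms(1,2) fdN]] by blast
  have "S \<noteq> {}"
  proof
    assume "S = {}"
    then have "carrier (Hom_space B E N) = H.span {}" using S(2) by (simp add: H.basis_def)
    also have "\<dots> = {\<zero>\<^bsub>Hom_space B E N\<^esub>}" by (auto simp: H.span_def H.lincomb_def)
    finally show False using nz by contradiction
  qed
  then show ?thesis using S H.dim_basis[OF S] by (simp add: hom_dim_def card_gt_0_iff)
qed

section \<open>Copositivity of integral quadratic forms\<close>

definition quad_form :: "nat \<Rightarrow> (nat \<Rightarrow> nat \<Rightarrow> real) \<Rightarrow> (nat \<Rightarrow> real) \<Rightarrow> real" where
  "quad_form n a x = (\<Sum>i<n. \<Sum>j<n. a i j * x i * x j)"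

lemma quad_form_cong:
  "(\<And>i. i < n \<Longrightarrow> x i = y i) \<Longrightarrow> quad_form n a x = quad_form n a y"
  by (simp add: quad_form_def)

lemma quad_form_scale: "quad_form n a (\<lambda>i. c * x i) = c\<^sup>2 * quad_form n a x"
  by (simp add: quad_form_def sum_distrib_left power2_eq_square mult_ac)

lemma quad_form_add:
  assumes sym: "\<And>i j. a i j = a j i"
  shows "quad_form n a (\<lambda>i. x i + y i) =
    quad_form n a x + 2 * (\<Sum>j<n. (\<Sum>i<n. a j i * x i) * y j) + quad_form n a y"
proof -
  define s where "s = (\<Sum>i<n. \<Sum>j<n. a i j * y i * x j)"
  have "(\<Sum>i<n. \<Sum>j<n. a i j * x i * y j) = (\<Sum>j<n. \<Sum>i<n. a i j * x i * y j)"
    by (rule sum.swap)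
  also have "\<dots> = s"
    unfolding s_def
  proof (intro sum.cong refl)
    fix i j show "a i j * x i * y j = a j i * y j * x i" by (subst sym[of i j]) simp
  qed
  finally have swap: "(\<Sum>i<n. \<Sum>j<n. a i j * x i * y j) = s" .
  have "(a i j * (x i + y i)) * (x j + y j)
      = a i j * x i * x j + a i j * x i * y j + a i j * y i * x j + a i j * y i * y j" for i j
    by (simp add: distrib_left distrib_right)
  then have "quad_form n a (\<lambda>i. x i + y i) = quad_form n a x + s + s + quad_form n a y"
    using swap by (simp add: quad_form_def sum.distrib s_def)
  moreover have "(\<Sum>j<n. (\<Sum>i<n. a j i * x i) * y j) = s"
    unfolding s_def sum_distrib_right by (intro sum.cong refl) simp
  ultimately show ?thesis by simp
qed

lemma quad_form_le_sum_abs: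
  assumes "\<And>i. i < n \<Longrightarrow> \<bar>y i\<bar> \<le> e"
  shows "quad_form n a y \<le> e\<^sup>2 * (\<Sum>i<n. \<Sum>j<n. \<bar>a i j\<bar>)"
proof -
  have "a i j * y i * y j \<le> e\<^sup>2 * \<bar>a i j\<bar>" if "i < n" "j < n" for i j
  proof -
    have "a i j * y i * y j \<le> \<bar>a i j\<bar> * (\<bar>y i\<bar> * \<bar>y j\<bar>)"
      by (metis abs_ge_self abs_mult mult.assoc)
    also have "\<dots> \<le> \<bar>a i j\<bar> * (e * e)"
      using that by (intro mult_left_mono mult_mono assms) (auto intro: order_trans[OF abs_ge_zero assms])
    finally show ?thesis by (simp add: power2_eq_square mult_ac)
  qed
  then show ?thesis unfolding quad_form_def sum_distrib_left by (intro sum_mono) auto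
qed

text \<open>Rounding a real point of the cone where the form is at most \<open>0\<close> to a vector of natural numbers.
For \<open>m = q x + d\<close> with \<open>d\<close> supported on the support of \<open>x\<close> and bounded by \<open>e\<close>, the form at \<open>m\<close> is
\<open>q\<^sup>2\<close> times the form at \<open>x\<close>, plus a linear term of size at most \<open>2 q e s\<close>, plus a term below \<open>1\<close>.
Here \<open>s\<close> is the sum of the absolute values of half the partial derivatives along the support.
The last hypothesis makes the linear term harmless: either the form at \<open>x\<close> is negative and \<open>e\<close> can be
chosen so small that it dominates, or \<open>s = 0\<close>. Integrality then rounds a value below \<open>1\<close> down
to at most \<open>0\<close>.\<close>

lemma nonpos_at_nat_vector_if_small_gradient:
  assumes int: "\<And>i j. a i j \<in> \<int>" and sym: "\<And>i j. a i j = a j i"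
    and x: "\<And>i. i < n \<Longrightarrow> 0 \<le> x i" and nz: "i0 < n" "x i0 \<noteq> 0"
    and q: "quad_form n a x \<le> 0"
    and grad: "quad_form n a x < 0 \<or> (\<forall>j<n. x j \<noteq> 0 \<longrightarrow> (\<Sum>i<n. a j i * x i) = 0)"
  shows "\<exists>m :: nat \<Rightarrow> nat. m i0 \<noteq> 0 \<and> quad_form n a (\<lambda>i. real (m i)) \<le> 0"
proof -
  define g where "g j = (\<Sum>i<n. a j i * x i)" for j
  define s where "s = (\<Sum>j\<in>{j. j < n \<and> x j \<noteq> 0}. \<bar>g j\<bar>)"
  define S where "S = (\<Sum>i<n. \<Sum>j<n. \<bar>a i j\<bar>)"
  have s0: "0 \<le> s" by (auto simp: s_def intro: sum_nonneg)
  have S0: "0 \<le> S" by (auto simp: S_def intro: sum_nonneg)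
  have ev0: "\<forall>\<^sub>F e in at_right 0. e < c" if "0 < c" for c :: real
    using that eventually_at_right_real[OF that] by (auto elim: eventually_mono)
  \<comment> \<open>The first bound on \<open>e\<close> keeps \<open>m\<close> positive on the support of \<open>x\<close>, and the bound by \<open>1\<close> keeps it
     zero elsewhere; together with the latter, the third makes the quadratic term less than \<open>1\<close>; the
     fourth absorbs the linear term.\<close>
  have "\<forall>\<^sub>F e in at_right (0::real). \<forall>i\<in>{i. i < n \<and> x i \<noteq> 0}. e < x i"
    using x by (intro eventually_ball_finite ballI ev0) (auto simp: order_less_le)
  moreover have "\<forall>\<^sub>F e in at_right (0::real). e < 1" by (rule ev0) simp
  moreover have "\<forall>\<^sub>F e in at_right (0::real). e < 1 / (S + 1)" using S0 by (intro ev0) simp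
  moreover have "\<forall>\<^sub>F e in at_right (0::real). 2 * e * s \<le> - quad_form n a x"
  proof (cases "s = 0")
    case True
    then show ?thesis using q by simp
  next
    case False
    then have "quad_form n a x < 0" using grad by (auto simp: s_def g_def)
    then have "0 < - quad_form n a x / (2 * s)" using False s0 by (intro divide_pos_pos) auto
    from ev0[OF this] show ?thesis
      by (rule eventually_mono) (use False s0 in \<open>simp add: field_simps\<close>)
  qed
  moreover have "\<forall>\<^sub>F e in at_right (0::real). 0 < e" by (rule eventually_at_right_less)
  ultimately have "\<forall>\<^sub>F e in at_right (0::real). (\<forall>i\<in>{i. i < n \<and> x i \<noteq> 0}. e < x i) \<and> e < 1 \<and>
      e < 1 / (S + 1) \<and> 2 * e * s \<le> - quad_form n a x \<and> 0 < e"
    by eventually_elim simp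
  then have "\<exists>e>0. (\<forall>i\<in>{i. i < n \<and> x i \<noteq> 0}. e < x i) \<and> e < 1 \<and>
      e < 1 / (S + 1) \<and> 2 * e * s \<le> - quad_form n a x"
    using eventually_happens'[OF trivial_limit_at_right_real] by fast
  then obtain e where e: "0 < e" "\<And>i. i < n \<Longrightarrow> x i \<noteq> 0 \<Longrightarrow> e < x i" "e < 1"
      "e < 1 / (S + 1)" "2 * e * s \<le> - quad_form n a x"
    by blast
  obtain N :: nat where N: "0 < N" "1 / real N < e"
    using reals_Archimedean[OF e(1)] by (auto simp: inverse_eq_divide intro: that[of "Suc _"])
  obtain q p where qp: "0 < (q::int)" "\<And>i. i < n \<Longrightarrow> \<bar>of_int q * x i - of_int (p i)\<bar> < 1 / N"
    using Dirichlet_approx_simult[OF N(1), of n x] by metis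
  have pe: "\<bar>of_int q * x i - of_int (p i)\<bar> < e" if "i < n" for i
    using qp(2)[OF that] N(2) by linarith
  have q1: "1 \<le> real_of_int q" using qp(1) by simp
  have p0: "p i = 0" if "i < n" "x i = 0" for i
    using pe[OF that(1)] that(2) e(3) by simp
  have ppos: "0 < p i" if "i < n" "x i \<noteq> 0" for i
  proof -
    have "x i \<le> of_int q * x i" using q1 x[OF that(1)] by (simp add: mult_le_cancel_right1)
    then have "0 < real_of_int (p i)" using pe[OF that(1)] e(2)[OF that] by linarith
    then show ?thesis by simp
  qed
  define m where "m i = nat (p i)" for i
  have mp: "real (m i) = of_int (p i)" if "i < n" for i
    using p0[OF that] ppos[OF that] by (cases "x i = 0") (auto simp: m_def)
  define d where "d i = real (m i) - of_int q * x i" for i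
  have d: "\<bar>d i\<bar> < e" if "i < n" for i using pe[OF that] mp[OF that] by (simp add: d_def)
  have d0: "d i = 0" if "i < n" "x i = 0" for i using p0[OF that] that(2) mp[OF that(1)] by (simp add: d_def)
  have lin: "(\<Sum>j<n. g j * d j) \<le> e * s"
  proof -
    have "(\<Sum>j<n. g j * d j) = (\<Sum>j\<in>{j. j < n \<and> x j \<noteq> 0}. g j * d j)"
      by (rule sum.mono_neutral_right) (auto simp: d0)
    also have "\<dots> \<le> (\<Sum>j\<in>{j. j < n \<and> x j \<noteq> 0}. e * \<bar>g j\<bar>)"
    proof (rule sum_mono)
      fix j assume "j \<in> {j. j < n \<and> x j \<noteq> 0}"
      then have "\<bar>d j\<bar> \<le> e" using d[of j] by simp
      have "g j * d j \<le> \<bar>g j\<bar> * \<bar>d j\<bar>" by (metis abs_ge_self abs_mult)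
      also have "\<dots> \<le> \<bar>g j\<bar> * e" by (intro mult_left_mono) (fact, simp)
      finally show "g j * d j \<le> e * \<bar>g j\<bar>" by (simp add: mult_ac)
    qed
    finally show ?thesis by (simp add: s_def sum_distrib_left)
  qed
  have quadd: "quad_form n a d < 1"
  proof -
    have "quad_form n a d \<le> e\<^sup>2 * S"
      unfolding S_def using d by (intro quad_form_le_sum_abs) (simp add: less_imp_le)
    also have "\<dots> \<le> e * S" using e(1,3) S0 by (intro mult_right_mono) (auto simp: power2_eq_square mult_le_cancel_left1)
    also have "\<dots> < 1" using e(1,4) S0 by (simp add: field_simps)
    finally show ?thesis .
  qed
  have "quad_form n a (\<lambda>i. real (m i)) = quad_form n a (\<lambda>i. of_int q * x i + d i)"
    by (simp add: d_def)
  also have "\<dots> = (of_int q)\<^sup>2 * quad_form n a x + 2 * of_int q * (\<Sum>j<n. g j * d j) + quad_form n a d"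
    by (subst quad_form_add[OF sym])
      (simp add: quad_form_scale g_def sum_distrib_left sum_distrib_right mult_ac)
  also have "\<dots> < (of_int q)\<^sup>2 * quad_form n a x + 2 * of_int q * (e * s) + 1"
    using lin q1 quadd by (intro add_le_less_mono add_left_mono mult_left_mono) auto
  also have "\<dots> \<le> (of_int q)\<^sup>2 * quad_form n a x + of_int q * (- quad_form n a x) + 1"
    using mult_left_mono[OF e(5), of "of_int q"] q1 by (simp add: mult_ac)
  also have "\<dots> = of_int q * (of_int q - 1) * quad_form n a x + 1"
    by (simp add: power2_eq_square algebra_simps)
  also have "\<dots> \<le> 1" using q q1 by (simp add: mult_nonneg_nonpos)
  finally have lt: "quad_form n a (\<lambda>i. real (m i)) < 1" .
  have "quad_form n a (\<lambda>i. real (m i)) \<in> \<int>"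
    unfolding quad_form_def by (intro Ints_sum Ints_mult int) auto
  then obtain z where "quad_form n a (\<lambda>i. real (m i)) = of_int z" by (auto elim: Ints_cases)
  then have "quad_form n a (\<lambda>i. real (m i)) \<le> 0" using lt by simp
  moreover have "m i0 \<noteq> 0" using ppos[OF nz] by (simp add: m_def)
  ultimately show ?thesis by blast
qed

text \<open>From \<open>x\<close> one can move a little in both directions of coordinate \<open>j\<close> without leaving the cone, and
\<open>x\<close> minimises the form there.\<close>

lemma gradient_vanishes_at_copositive_zero:
  assumes sym: "\<And>i j. a i j = a j i"
    and cop: "\<And>y. (\<And>i. i < n \<Longrightarrow> 0 \<le> y i) \<Longrightarrow> 0 \<le> quad_form n a y"
    and x: "\<And>i. i < n \<Longrightarrow> 0 \<le> x i" and zero: "quad_form n a x = 0"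
    and j: "j < n" "x j \<noteq> 0"
  shows "(\<Sum>i<n. a j i * x i) = 0"
proof (rule ccontr)
  define g where "g = (\<Sum>i<n. a j i * x i)"
  assume "(\<Sum>i<n. a j i * x i) \<noteq> 0"
  then have g: "g \<noteq> 0" by (simp add: g_def)
  \<comment> \<open>A step of length \<open>\<tau>\<close> against the sign of \<open>g\<close>: it stays in the cone, and it is so short that the
     linear term outweighs the quadratic one.\<close>
  define \<tau> where "\<tau> = min (x j) (\<bar>g\<bar> / (\<bar>a j j\<bar> + 1))"
  have \<tau>: "0 < \<tau>" "\<tau> \<le> x j" "\<tau> \<le> \<bar>g\<bar> / (\<bar>a j j\<bar> + 1)"
    using g j x[OF j(1)] by (auto simp: \<tau>_def)
  define t where "t = - sgn g * \<tau>"
  define e where "e i = (if i = j then t else 0)" for i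
  have "0 \<le> quad_form n a (\<lambda>i. x i + e i)"
    using x \<tau> by (intro cop) (auto simp: e_def t_def sgn_real_def)
  also have "\<dots> = 2 * (\<Sum>k<n. (\<Sum>i<n. a k i * x i) * e k) + quad_form n a e"
    by (simp add: quad_form_add[OF sym] zero)
  also have "(\<Sum>k<n. (\<Sum>i<n. a k i * x i) * e k) = g * t"
    using j(1) by (simp add: e_def g_def mult_delta_right)
  also have "quad_form n a e = a j j * t\<^sup>2"
  proof -
    have "(\<Sum>l<n. a k l * e k * e l) = a k j * e k * t" for k
      using j(1) by (simp add: e_def mult_delta_right)
    then show ?thesis
      using j(1) by (simp add: quad_form_def e_def mult_delta_right mult_delta_left power2_eq_square)
  qed
  also have "t\<^sup>2 = \<tau>\<^sup>2" using g by (simp add: t_def power_mult_distrib sgn_real_def)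
  also have "g * t = - \<bar>g\<bar> * \<tau>" by (simp add: t_def abs_sgn)
  finally have "2 * \<bar>g\<bar> * \<tau> \<le> a j j * \<tau> * \<tau>" by (simp add: power2_eq_square)
  then have "2 * \<bar>g\<bar> \<le> a j j * \<tau>" using \<tau>(1) by simp
  also have "\<dots> \<le> (\<bar>a j j\<bar> + 1) * \<tau>" using \<tau>(1) by (intro mult_right_mono) auto
  also have "\<dots> \<le> \<bar>g\<bar>" using \<tau>(3) by (simp add: pos_le_divide_eq add_nonneg_pos mult.commute)
  finally show False using g by simp
qed

text \<open>The rounding lemma is applied twice: at points where the form is negative, to show that the
form is nonnegative on the cone; then at its zeros, where nonnegativity makes the gradient vanish
along the support.\<close>

theorem strictly_copositive_if_pos_on_nat_vectors:
  assumes int: "\<And>i j. a i j \<in> \<int>" and sym: "\<And>i j. a i j = a j i"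
    and pos: "\<And>m :: nat \<Rightarrow> nat. \<exists>i<n. m i \<noteq> 0 \<Longrightarrow> 0 < quad_form n a (\<lambda>i. real (m i))"
    and x: "\<And>i. i < n \<Longrightarrow> 0 \<le> x i" and nz: "\<exists>i<n. x i \<noteq> 0"
  shows "0 < quad_form n a x"
proof (rule ccontr)
  have cop: "0 \<le> quad_form n a y" if y: "\<And>i. i < n \<Longrightarrow> 0 \<le> y i" for y
  proof (rule ccontr)
    assume neg: "\<not> 0 \<le> quad_form n a y"
    then have "\<exists>i<n. y i \<noteq> 0" by (auto simp: quad_form_def intro!: sum_nonneg)
    then obtain i where iy: "i < n" "y i \<noteq> 0" by blast
    have "\<exists>m :: nat \<Rightarrow> nat. m i \<noteq> 0 \<and> quad_form n a (\<lambda>i. real (m i)) \<le> 0"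
      using y neg iy by (intro nonpos_at_nat_vector_if_small_gradient[where x = y] int sym) auto
    then obtain m :: "nat \<Rightarrow> nat" where "m i \<noteq> 0" "quad_form n a (\<lambda>i. real (m i)) \<le> 0" by blast
    then show False using pos[of m] iy(1) by auto
  qed
  assume "\<not> 0 < quad_form n a x"
  then have zero: "quad_form n a x = 0" using cop[of x, OF x] by simp
  obtain i where i: "i < n" "x i \<noteq> 0" using nz by blast
  have grad: "\<forall>j<n. x j \<noteq> 0 \<longrightarrow> (\<Sum>i<n. a j i * x i) = 0"
    using gradient_vanishes_at_copositive_zero[where a = a, OF sym cop x zero] by blast
  have "\<exists>m :: nat \<Rightarrow> nat. m i \<noteq> 0 \<and> quad_form n a (\<lambda>i. real (m i)) \<le> 0"
    using x zero grad i by (intro nonpos_at_nat_vector_if_small_gradient[where x = x] int sym) auto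
  then obtain m :: "nat \<Rightarrow> nat" where "m i \<noteq> 0" "quad_form n a (\<lambda>i. real (m i)) \<le> 0" by blast
  then show False using pos[of m] i(1) by auto
qed

text \<open>The minimum of the form on the standard simplex is positive; homogeneity extends the bound to
the cone.\<close>

lemma strictly_copositive_bound:
  assumes pos: "\<And>x. (\<And>i. i < n \<Longrightarrow> 0 \<le> x i) \<Longrightarrow> \<exists>i<n. x i \<noteq> 0 \<Longrightarrow> 0 < quad_form n a x"
  shows "\<exists>c>0. \<forall>x. (\<forall>i<n. 0 \<le> x i) \<longrightarrow> c * (\<Sum>i<n. x i)\<^sup>2 \<le> quad_form n a x"
proof -
  \<comment> \<open>The form does not see the coordinates from \<open>n\<close> on; pinning them to \<open>0\<close> makes the simplex
     compact in the product topology.\<close>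
  define D where "D = {x \<in> PiE UNIV (\<lambda>i. if i < n then {0..1} else {0}). (\<Sum>i<n. x i) = (1::real)}"
  have "compactin (product_topology (\<lambda>i. euclidean) UNIV)
      (PiE UNIV (\<lambda>i. if i < n then {0..1} else {0::real}))"
    by (auto simp: compactin_PiE)
  then have "compact (PiE UNIV (\<lambda>i. if i < n then {0..1} else {0::real}))"
    by (simp add: euclidean_product_topology)
  moreover have "closed {x :: nat \<Rightarrow> real. (\<Sum>i<n. x i) = 1}"
    by (intro closed_Collect_eq continuous_intros continuous_on_product_coordinates)
  moreover have "D = PiE UNIV (\<lambda>i. if i < n then {0..1} else {0}) \<inter> {x. (\<Sum>i<n. x i) = 1}"
    by (auto simp: D_def)
  ultimately have comp: "compact D" by (simp add: compact_Int_closed)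
  have cont: "continuous_on D (quad_form n a)"
    unfolding quad_form_def
    by (intro continuous_intros continuous_on_subset[OF continuous_on_product_coordinates]) auto
  have "\<exists>c>0. \<forall>x\<in>D. c \<le> quad_form n a x"
  proof (cases "D = {}")
    case False
    obtain x where x: "x \<in> D" "\<forall>y\<in>D. quad_form n a x \<le> quad_form n a y"
      using continuous_attains_inf[OF comp False cont] by blast
    have "0 < quad_form n a x"
    proof (rule pos)
      show "0 \<le> x i" if "i < n" for i using x(1) that by (auto simp: D_def PiE_iff split: if_splits)
      have "(\<Sum>i<n. x i) \<noteq> 0" using x(1) by (simp add: D_def)
      then show "\<exists>i<n. x i \<noteq> 0" by (metis lessThan_iff sum.neutral)
    qed
    then show ?thesis using x by blast
  qed (auto intro: exI[of _ 1])
  then obtain c where c: "0 < c" "\<And>x. x \<in> D \<Longrightarrow> c \<le> quad_form n a x" by blast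
  have "c * (\<Sum>i<n. x i)\<^sup>2 \<le> quad_form n a x" if x: "\<And>i. i < n \<Longrightarrow> 0 \<le> x i" for x
  proof (cases "(\<Sum>i<n. x i) = 0")
    case True
    then have "x i = 0" if "i < n" for i using True x that sum_nonneg_eq_0_iff[of "{..<n}" x] by auto
    then show ?thesis using True by (simp add: quad_form_def)
  next
    case False
    define \<sigma> where "\<sigma> = (\<Sum>i<n. x i)"
    have "0 \<le> \<sigma>" unfolding \<sigma>_def using x by (intro sum_nonneg) auto
    then have \<sigma>: "0 < \<sigma>" using False by (simp add: \<sigma>_def)
    define y where "y i = (if i < n then x i / \<sigma> else 0)" for i
    have "x i \<le> \<sigma>" if "i < n" for i
      unfolding \<sigma>_def using x that by (intro member_le_sum) auto
    then have "y \<in> D" using x \<sigma> by (auto simp: D_def y_def PiE_iff sum_divide_distrib[symmetric] \<sigma>_def)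
    then have "c \<le> quad_form n a y" by (rule c)
    then have "c * \<sigma>\<^sup>2 \<le> \<sigma>\<^sup>2 * quad_form n a y" using \<sigma> by (simp add: mult.commute)
    also have "\<dots> = quad_form n a (\<lambda>i. \<sigma> * y i)" by (simp add: quad_form_scale)
    also have "\<dots> = quad_form n a x" using \<sigma> by (intro quad_form_cong) (simp add: y_def)
    finally show ?thesis by (simp add: \<sigma>_def)
  qed
  then show ?thesis using c(1) by blast
qed

section \<open>Admissible pairs\<close>

definition Q_coeff :: "('k, 'a) ring_scheme \<Rightarrow> ('k, 'b, 'c) module_scheme
    \<Rightarrow> ('b, 'm, 'd) module_scheme \<Rightarrow> ('b, 'n) module list \<Rightarrow> nat \<Rightarrow> nat \<Rightarrow> real" where
  "Q_coeff K B E Xs i j =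
    2 * (real (hom_dim K B (Xs ! i) (Xs ! j)) + real (hom_dim K B (Xs ! j) (Xs ! i)))
    - real (hom_dim K B E (Xs ! i)) * real (hom_dim K B E (Xs ! j))"

lemma Q_coeff_Ints: "Q_coeff K B E Xs i j \<in> \<int>"
  by (simp add: Q_coeff_def)

lemma Q_coeff_commute: "Q_coeff K B E Xs i j = Q_coeff K B E Xs j i"
  by (simp add: Q_coeff_def)

lemma h_form_eq_sum:
  assumes "x \<in> carrier_vec (length Xs)"
  shows "h_form K B E Xs x = (\<Sum>i<length Xs. real (hom_dim K B E (Xs ! i)) * x $ i)"
  using assms by (simp add: h_form_def d_vec_def scalar_prod_def atLeast0LessThan)

lemma Q_form_eq_quad_form:
  assumes "x \<in> carrier_vec (length Xs)"
  shows "Q_form K B E Xs x = quad_form (length Xs) (Q_coeff K B E Xs) (\<lambda>i. x $ i)"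
proof -
  let ?n = "length Xs"
  let ?c = "\<lambda>i j. real (hom_dim K B (Xs ! i) (Xs ! j))"
  let ?d = "\<lambda>i. real (hom_dim K B E (Xs ! i))"
  have "4 * r_form K B Xs x = (\<Sum>i<?n. \<Sum>j<?n. 2 * (?c i j + ?c j i) * x $ i * x $ j)"
    using assms
    by (simp add: r_form_def G_mat_def C_mat_def scalar_prod_def atLeast0LessThan
        sum_distrib_left sum_distrib_right algebra_simps)
  moreover have "(h_form K B E Xs x)\<^sup>2 = (\<Sum>i<?n. \<Sum>j<?n. ?d i * ?d j * x $ i * x $ j)"
    by (simp add: h_form_eq_sum[OF assms] power2_eq_square sum_product mult_ac)
  ultimately show ?thesis
    by (simp add: Q_form_def quad_form_def Q_coeff_def algebra_simps flip: sum_subtractf)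
qed

lemma admissible_iff_Q_form:
  "admissible K B E Xs m l \<longleftrightarrow>
    m \<in> carrier_vec (length Xs) \<and> m \<noteq> 0\<^sub>v (length Xs) \<and>
    1 \<le> l \<and> real_of_int l \<le> h_form K B E Xs (map_vec real m) \<and>
    Q_form K B E Xs (map_vec real m) + (h_form K B E Xs (map_vec real m) - 2 * real_of_int l)\<^sup>2 \<le> 4"
  by (auto simp: admissible_def Q_form_def power2_eq_square algebra_simps)

lemma strict_admissible_iff_Q_form:
  "strict_admissible K B E Xs m l \<longleftrightarrow> admissible K B E Xs m l \<and>
    Q_form K B E Xs (map_vec real m) + (h_form K B E Xs (map_vec real m) - 2 * real_of_int l)\<^sup>2 < 4"
  by (auto simp: strict_admissible_def Q_form_def power2_eq_square algebra_simps)

text \<open>The factor \<open>1/2\<close> in the symmetrised matrix disappears: a quadratic form does not see the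
difference between a matrix and its transpose.\<close>

lemma r_form_nat_Ints:
  assumes "m \<in> carrier_vec (length Xs)"
  shows "r_form K B Xs (map_vec real m) \<in> \<int>"
proof -
  let ?n = "length Xs"
  let ?c = "\<lambda>i j. real (hom_dim K B (Xs ! i) (Xs ! j))"
  let ?m = "\<lambda>i. real (m $ i)"
  have "(\<Sum>i<?n. \<Sum>j<?n. ?c j i * ?m i * ?m j) = (\<Sum>i<?n. \<Sum>j<?n. ?c i j * ?m i * ?m j)"
    by (subst sum.swap) (simp add: mult_ac)
  moreover have "2 * r_form K B Xs (map_vec real m) =
      (\<Sum>i<?n. \<Sum>j<?n. ?c i j * ?m i * ?m j) + (\<Sum>i<?n. \<Sum>j<?n. ?c j i * ?m i * ?m j)"
    using assms
    by (simp add: r_form_def G_mat_def C_mat_def scalar_prod_def atLeast0LessThan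
        sum_distrib_left sum_distrib_right algebra_simps flip: sum.distrib)
  ultimately have "r_form K B Xs (map_vec real m) = (\<Sum>i<?n. \<Sum>j<?n. ?c i j * ?m i * ?m j)"
    by simp
  also have "\<dots> \<in> \<int>" by (intro Ints_sum Ints_mult) auto
  finally show ?thesis .
qed

text \<open>The number \<open>r(m) - l (h(m) - l)\<close> is an integer less than \<open>1\<close>, hence at most \<open>0\<close>.\<close>

lemma Q_form_nonpos_if_strict_admissible:
  assumes "strict_admissible K B E Xs m l"
  shows "Q_form K B E Xs (map_vec real m) \<le> 0"
proof -
  let ?r = "r_form K B Xs (map_vec real m)" and ?h = "h_form K B E Xs (map_vec real m)"
  have m: "m \<in> carrier_vec (length Xs)"
    using assms by (simp add: strict_admissible_def admissible_def)
  define D where "D = ?r - real_of_int l * (?h - real_of_int l)"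
  have "?h \<in> \<int>"
    using m by (subst h_form_eq_sum) (auto intro!: Ints_sum Ints_mult)
  then have "D \<in> \<int>"
    unfolding D_def using r_form_nat_Ints[OF m, of K B] by (intro Ints_diff Ints_mult) auto
  then obtain z where "D = of_int z" by (auto elim: Ints_cases)
  moreover have "D < 1" using assms by (simp add: strict_admissible_def D_def)
  ultimately have "D \<le> 0" by simp
  moreover have "Q_form K B E Xs (map_vec real m) = 4 * D - (?h - 2 * real_of_int l)\<^sup>2"
    by (simp add: D_def Q_form_def power2_eq_square algebra_simps)
  ultimately show ?thesis using zero_le_power2[of "?h - 2 * real_of_int l"] by linarith
qed

text \<open>The factor \<open>2\<close> makes \<open>h\<close> even, so that \<open>l\<close> can be chosen as exactly half of it. The factor \<open>k\<close>
provides infinitely many pairs.\<close>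

lemma strict_admissible_even_multiple:
  fixes m :: "nat vec" and k :: nat
  assumes dpos: "\<And>i. i < length Xs \<Longrightarrow> 0 < hom_dim K B E (Xs ! i)"
    and m: "m \<in> carrier_vec (length Xs)" "m \<noteq> 0\<^sub>v (length Xs)"
    and Q: "Q_form K B E Xs (map_vec real m) \<le> 0"
    and k: "0 < k"
  shows "strict_admissible K B E Xs ((2 * k) \<cdot>\<^sub>v m)
    (int (k * (\<Sum>i<length Xs. hom_dim K B E (Xs ! i) * m $ i)))"
proof -
  let ?n = "length Xs"
  let ?h = "\<Sum>i<?n. hom_dim K B E (Xs ! i) * m $ i"
  let ?v = "(2 * k) \<cdot>\<^sub>v m"
  obtain i where i: "i < ?n" "m $ i \<noteq> 0"
    using m by (metis carrier_vecD eq_vecI index_zero_vec(1) index_zero_vec(2))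
  have "0 < hom_dim K B E (Xs ! i) * m $ i" using dpos[OF i(1)] i(2) by simp
  also have "\<dots> \<le> ?h" using i(1) by (intro member_le_sum) auto
  finally have hpos: "0 < ?h" .
  have v: "?v \<in> carrier_vec ?n" using m(1) by simp
  have vi: "real (?v $ j) = real (2 * k) * real (m $ j)" if "j < ?n" for j
    using that m(1) by simp
  have "?v $ i \<noteq> 0" using i m(1) k by simp
  then have v0: "?v \<noteq> 0\<^sub>v ?n" using i(1) by auto
  have hv: "h_form K B E Xs (map_vec real ?v) = 2 * real (k * ?h)"
    using m(1) by (subst h_form_eq_sum) (simp_all add: sum_distrib_left mult_ac)
  have "Q_form K B E Xs (map_vec real ?v) = (real (2 * k))\<^sup>2 * Q_form K B E Xs (map_vec real m)"
  proof -
    have "Q_form K B E Xs (map_vec real ?v) =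
        quad_form ?n (Q_coeff K B E Xs) (\<lambda>j. real (2 * k) * (map_vec real m $ j))"
      using v m(1) by (subst Q_form_eq_quad_form) (auto intro!: quad_form_cong)
    then show ?thesis using m(1) by (simp add: quad_form_scale Q_form_eq_quad_form)
  qed
  then have "Q_form K B E Xs (map_vec real ?v) \<le> 0"
    using Q by (simp add: mult_nonneg_nonpos)
  moreover have "1 \<le> int (k * ?h)"
    using mult_pos_pos[OF k hpos] by (metis Suc_leI One_nat_def of_nat_1 of_nat_le_iff)
  moreover have "real_of_int (int (k * ?h)) \<le> h_form K B E Xs (map_vec real ?v)"
    unfolding hv of_int_of_nat_eq by linarith
  moreover have "h_form K B E Xs (map_vec real ?v) - 2 * real_of_int (int (k * ?h)) = 0"
    unfolding hv of_int_of_nat_eq by simp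
  ultimately show ?thesis
    using v v0 unfolding strict_admissible_iff_Q_form admissible_iff_Q_form by simp
qed

lemma finite_bounded_nat_vecs: "finite {m :: nat vec. m \<in> carrier_vec n \<and> (\<forall>i<n. m $ i \<le> b)}"
proof (rule finite_subset)
  show "{m :: nat vec. m \<in> carrier_vec n \<and> (\<forall>i<n. m $ i \<le> b)} \<subseteq> vec n ` PiE {..<n} (\<lambda>_. {..b})"
  proof
    fix m :: "nat vec" assume "m \<in> {m. m \<in> carrier_vec n \<and> (\<forall>i<n. m $ i \<le> b)}"
    then have "m = vec n (\<lambda>i\<in>{..<n}. m $ i)" "(\<lambda>i\<in>{..<n}. m $ i) \<in> PiE {..<n} (\<lambda>_. {..b})"
      by (auto intro!: eq_vecI)
    then show "m \<in> vec n ` PiE {..<n} (\<lambda>_. {..b})" by blast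
  qed
qed (auto intro: finite_PiE)

text \<open>Admissibility gives \<open>Q(m) \<le> 4\<close>. With \<open>Q(m) \<ge> c s\<^sup>2 \<ge> c s\<close>, where \<open>s\<close> is the sum of the entries
of \<open>m\<close>, this bounds every entry by \<open>4 / c\<close>, and then \<open>l \<le> h(m)\<close> is bounded as well.\<close>

lemma finite_admissible_if_strictly_copositive:
  assumes pos: "\<And>x. x \<in> carrier_vec (length Xs) \<Longrightarrow> (\<And>i. i < length Xs \<Longrightarrow> 0 \<le> x $ i) \<Longrightarrow>
    x \<noteq> 0\<^sub>v (length Xs) \<Longrightarrow> 0 < Q_form K B E Xs x"
  shows "finite {(m, l). admissible K B E Xs m l}"
proof -
  let ?n = "length Xs"
  let ?q = "quad_form ?n (Q_coeff K B E Xs)"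
  have "\<exists>c>0. \<forall>x. (\<forall>i<?n. 0 \<le> x i) \<longrightarrow> c * (\<Sum>i<?n. x i)\<^sup>2 \<le> ?q x"
  proof (rule strictly_copositive_bound)
    fix x :: "nat \<Rightarrow> real"
    assume x: "\<And>i. i < ?n \<Longrightarrow> 0 \<le> x i" and nz: "\<exists>i<?n. x i \<noteq> 0"
    have "vec ?n x \<noteq> 0\<^sub>v ?n" using nz by (metis index_vec index_zero_vec(1))
    then have "0 < Q_form K B E Xs (vec ?n x)" using x by (intro pos) auto
    also have "\<dots> = ?q x" by (subst Q_form_eq_quad_form) (auto intro: quad_form_cong)
    finally show "0 < ?q x" .
  qed
  then obtain c where c: "0 < c"
    "\<And>x. \<forall>i<?n. 0 \<le> x i \<Longrightarrow> c * (\<Sum>i<?n. x i)\<^sup>2 \<le> ?q x"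
    by blast
  define b where "b = nat \<lfloor>4 / c\<rfloor>"
  define H where "H = (\<Sum>i<?n. hom_dim K B E (Xs ! i) * b)"
  have bound: "(\<forall>i<?n. m $ i \<le> b) \<and> m \<in> carrier_vec ?n \<and> l \<in> {1..int H}" if adm: "admissible K B E Xs m l" for m l
  proof -
    have m: "m \<in> carrier_vec ?n" and l: "1 \<le> l" "real_of_int l \<le> h_form K B E Xs (map_vec real m)"
      using adm by (auto simp: admissible_def)
    let ?s = "\<Sum>i<?n. m $ i"
    have "Q_form K B E Xs (map_vec real m)
        + (h_form K B E Xs (map_vec real m) - 2 * real_of_int l)\<^sup>2 \<le> 4"
      using adm by (simp add: admissible_iff_Q_form)
    then have "Q_form K B E Xs (map_vec real m) \<le> 4"
      using zero_le_power2[of "h_form K B E Xs (map_vec real m) - 2 * real_of_int l"] by linarith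
    then have "?q (\<lambda>i. real (m $ i)) \<le> 4"
      using m Q_form_eq_quad_form[of "map_vec real m" Xs K B E]
        quad_form_cong[of ?n "\<lambda>i. map_vec real m $ i" "\<lambda>i. real (m $ i)" "Q_coeff K B E Xs"] by simp
    then have "c * (real ?s)\<^sup>2 \<le> 4"
      using c(2)[of "\<lambda>i. real (m $ i)"] by simp
    moreover have "real ?s \<le> (real ?s)\<^sup>2"
      by (metis le_square of_nat_le_iff of_nat_mult power2_eq_square)
    ultimately have "c * real ?s \<le> 4"
      using c(1) by (meson mult_left_mono less_imp_le order_trans)
    then have "real ?s \<le> 4 / c" using c(1) by (simp add: field_simps)
    then have sb: "?s \<le> b" by (simp add: b_def le_nat_floor)
    have mb: "m $ i \<le> b" if "i < ?n" for i
      using member_le_sum[of i "{..<?n}" "\<lambda>i. m $ i"] that sb by simp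
    have "h_form K B E Xs (map_vec real m) = real (\<Sum>i<?n. hom_dim K B E (Xs ! i) * m $ i)"
      using m by (subst h_form_eq_sum) auto
    also have "\<dots> \<le> real H"
      unfolding H_def of_nat_le_iff using mb by (intro sum_mono mult_left_mono) auto
    finally have "l \<le> int H" using l(2) by linarith
    then show ?thesis using mb m l(1) by auto
  qed
  have "{(m, l). admissible K B E Xs m l} \<subseteq>
      {m. m \<in> carrier_vec ?n \<and> (\<forall>i<?n. m $ i \<le> b)} \<times> {1..int H}"
    using bound by auto
  then show ?thesis
    by (rule finite_subset) (intro finite_cartesian_product finite_bounded_nat_vecs finite_atLeastAtMost_int)
qed

theorem theorem3p16:
  fixes K :: "('k, 'a) ring_scheme"
    and B :: "('k, 'b, 'c) module_scheme"
    and E :: "('b, 'm, 'd) module_scheme"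
    and Xs :: "('b, nat \<Rightarrow> 'k) module list"
  assumes "algebraically_closed K"
    and "fd_algebra K B"
    and "fd_right_module K B E"
    and "visible_finite K B E"
    and "complete_representatives K B E Xs"
  shows "((\<nexists>m l. strict_admissible K B E Xs m l)
            \<longleftrightarrow> finite {(m, l). admissible K B E Xs m l})
       \<and> (finite {(m, l). admissible K B E Xs m l}
            \<longleftrightarrow> (\<forall>x \<in> carrier_vec (length Xs).
                  (\<forall>i < length Xs. 0 \<le> x $ i) \<and> x \<noteq> 0\<^sub>v (length Xs) \<longrightarrow> 0 < Q_form K B E Xs x))
       \<and> ((\<forall>x \<in> carrier_vec (length Xs).
              (\<forall>i < length Xs. 0 \<le> x $ i) \<and> x \<noteq> 0\<^sub>v (length Xs) \<longrightarrow> 0 < Q_form K B E Xs x)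
            \<longleftrightarrow> (\<forall>m :: nat vec. m \<in> carrier_vec (length Xs) \<and> m \<noteq> 0\<^sub>v (length Xs)
                  \<longrightarrow> 0 < Q_form K B E Xs (map_vec real m)))"
proof -
  let ?n = "length Xs"
  let ?pos = "\<forall>x \<in> carrier_vec ?n.
    (\<forall>i < ?n. 0 \<le> x $ i) \<and> x \<noteq> 0\<^sub>v ?n \<longrightarrow> 0 < Q_form K B E Xs x"
  let ?natpos = "\<forall>m :: nat vec. m \<in> carrier_vec ?n \<and> m \<noteq> 0\<^sub>v ?n
    \<longrightarrow> 0 < Q_form K B E Xs (map_vec real m)"
  let ?fin = "finite {(m, l). admissible K B E Xs m l}"
  have dpos: "0 < hom_dim K B E (Xs ! i)" if "i < ?n" for i
  proof (rule hom_dim_pos_if_visible[OF assms(2,3)])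
    show "Xs ! i \<in> visible_modules K B E"
      using assms(5) that by (auto simp: complete_representatives_def)
  qed
  have "?natpos" if "\<nexists>m l. strict_admissible K B E Xs m l"
    using strict_admissible_even_multiple[OF dpos, where k = 1] that by (meson less_numeral_extra(1) not_le)
  moreover have "\<nexists>m l. strict_admissible K B E Xs m l" if ?natpos
    using that Q_form_nonpos_if_strict_admissible
    by (metis admissible_def not_le strict_admissible_def)
  moreover have ?natpos if ?fin
  proof (rule ccontr)
    assume "\<not> ?natpos"
    then obtain m :: "nat vec" where m: "m \<in> carrier_vec ?n" "m \<noteq> 0\<^sub>v ?n"
      "Q_form K B E Xs (map_vec real m) \<le> 0" by (auto simp: not_less)
    let ?h = "\<Sum>i<?n. hom_dim K B E (Xs ! i) * m $ i"
    define f where "f k = ((2 * k) \<cdot>\<^sub>v m, int (k * ?h))" for k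
    have str: "strict_admissible K B E Xs (fst (f k)) (snd (f k))" if "0 < k" for k
      using strict_admissible_even_multiple[OF dpos m that] by (simp add: f_def)
    have "1 \<le> snd (f 1)" using str[of 1] by (simp add: strict_admissible_def admissible_def)
    then have "inj f" by (auto simp: f_def intro!: injI)
    moreover have "f ` {0<..} \<subseteq> {(m, l). admissible K B E Xs m l}"
      using str by (auto simp: strict_admissible_def case_prod_unfold)
    ultimately have "finite {0 :: nat<..}"
      using that by (meson finite_imageD finite_subset inj_on_subset subset_UNIV)
    then show False by (simp add: infinite_Ioi)
  qed
  moreover have ?fin if ?pos
    using that by (intro finite_admissible_if_strictly_copositive) blast
  moreover have ?natpos if ?pos
  proof (intro allI impI)
    fix m :: "nat vec" assume m: "m \<in> carrier_vec ?n \<and> m \<noteq> 0\<^sub>v ?n"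
    then have "map_vec real m \<noteq> 0\<^sub>v ?n"
      by (auto simp: vec_eq_iff)
    then show "0 < Q_form K B E Xs (map_vec real m)" using that m by auto
  qed
  moreover have ?pos if natpos: ?natpos
  proof (intro ballI impI)
    fix x :: "real vec" assume x: "x \<in> carrier_vec ?n" "(\<forall>i<?n. 0 \<le> x $ i) \<and> x \<noteq> 0\<^sub>v ?n"
    have "0 < quad_form ?n (Q_coeff K B E Xs) (\<lambda>i. x $ i)"
    proof (rule strictly_copositive_if_pos_on_nat_vectors[OF Q_coeff_Ints Q_coeff_commute])
      fix m :: "nat \<Rightarrow> nat" assume "\<exists>i<?n. m i \<noteq> 0"
      then have "vec ?n m \<noteq> 0\<^sub>v ?n" by (metis index_vec index_zero_vec(1))
      then have "0 < Q_form K B E Xs (map_vec real (vec ?n m))" using natpos by simp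
      also have "\<dots> = quad_form ?n (Q_coeff K B E Xs) (\<lambda>i. real (m i))"
        by (subst Q_form_eq_quad_form) (auto intro: quad_form_cong)
      finally show "0 < quad_form ?n (Q_coeff K B E Xs) (\<lambda>i. real (m i))" .
    next
      show "\<exists>i<?n. x $ i \<noteq> 0" using x by (metis carrier_vecD eq_vecI index_zero_vec(1) index_zero_vec(2))
    qed (use x in auto)
    then show "0 < Q_form K B E Xs x" using x(1) by (simp add: Q_form_eq_quad_form)
  qed
  ultimately show ?thesis by blast
qed

end
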